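(* Let $\varphi$ be a (complex-valued) function on $\mathbb{D}^2$. Then $\varphi\in\mathcal{S}_2^{\mathrm{lf}}$ if and only if there exists a function $x\in\mathrm{Hol}(\mathbb{D},\overline{\mathcal{E}})$ such that $\varphi(z,\lambda)=\Psi(z,x(\lambda))$ for all $z,\lambda\in\mathbb{D}$.
   Context: $\mathbb{D}$ is the open unit disc. The closed tetrablock is $\overline{\mathcal{E}}=\{(x_1,x_2,x_3)\in\mathbb{C}^3:1-x_1z-x_2w+x_3zw\neq 0\text{ for all }z,w\in\mathbb{D}\}$; $\mathrm{Hol}(\mathbb{D},\overline{\mathcal{E}})$ is the set of analytic maps from $\mathbb{D}$ to $\overline{\mathcal{E}}$. $\Psi(z,x_1,x_2,x_3)=\dfrac{x_3z-x_1}{x_2z-1}$ for $x_2z\neq1$. $\mathcal{S}_2$ is the Schur class of the bidisc: analytic functions $\varphi:\mathbb{D}^2\to\overline{\mathbb{D}}$. $\mathcal{S}_2^{\mathrm{lf}}$ is the set of those $\varphi\in\mathcal{S}_2$ for which $\varphi(\cdot,\lambda)$ is a linear fractional map of the form $$\varphi(z,\lambda)=\frac{a(\lambda)z+b(\lambda)}{c(\lambda)z+1}\quad\text{for all }z,\lambda\in\mathbb{D},$$ where $a,b,c:\mathbb{D}\to\mathbb{C}$ are functions, $c$ is analytic on $\mathbb{D}$, and if $a(\lambda)=b(\lambda)c(\lambda)$ for some $\lambda\in\mathbb{D}$ then, in addition, $|c(\lambda)|\le1$. (Constant functions of $z$ are allowed as linear fractional maps. It then follows that $a$ and $b$ are analytic.)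 *)

theory Defs
  imports "HOL-Complex_Analysis.Complex_Analysis"
begin

abbreviation unit_disc :: "complex set" where
  "unit_disc \<equiv> ball 0 1"

definition closed_tetrablock :: "(complex ^ 3) set" where
  "closed_tetrablock =
     {x. \<forall>z\<in>unit_disc. \<forall>w\<in>unit_disc. 1 - x $ 1 * z - x $ 2 * w + x $ 3 * z * w \<noteq> 0}"

definition Hol_disc_tetrablock :: "(complex \<Rightarrow> complex ^ 3) set" where
  "Hol_disc_tetrablock =
     {x. (\<forall>i. (\<lambda>l. x l $ i) holomorphic_on unit_disc) \<and>
         (\<forall>l\<in>unit_disc. x l \<in> closed_tetrablock)}"

text \<open>Meaningful for \<open>x $ 2 * z \<noteq> 1\<close>. For \<open>x\<close> in the closed tetrablock and \<open>z\<close> in the unit disc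
  this always holds (take \<open>0\<close> and \<open>z\<close> for the two disc variables in the definition above).\<close>

definition Psi :: "complex \<Rightarrow> complex ^ 3 \<Rightarrow> complex" where
  "Psi z x = (x $ 3 * z - x $ 1) / (x $ 2 * z - 1)"

text \<open>Analyticity in two complex variables: the two-variable form of \<^const>\<open>holomorphic_on\<close>,
  i.e. at every point the (Frechet) derivative exists and is complex linear, with \<open>A\<close>, \<open>B\<close> the
  two partial derivatives. Only used for open \<open>S\<close>.\<close>

definition holomorphic2_on :: "(complex \<times> complex \<Rightarrow> complex) \<Rightarrow> (complex \<times> complex) set \<Rightarrow> bool"
    (infixl "(holomorphic2'_on)" 50) where
  "f holomorphic2_on S \<longleftrightarrow>
     (\<forall>p\<in>S. \<exists>A B. (f has_derivative (\<lambda>(h, k). A * h + B * k)) (at p within S))"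

definition schur2 :: "(complex \<times> complex \<Rightarrow> complex) set" where
  "schur2 = {\<phi>. \<phi> holomorphic2_on (unit_disc \<times> unit_disc) \<and>
                (\<forall>p \<in> unit_disc \<times> unit_disc. \<phi> p \<in> cball 0 1)}"

text \<open>No separate condition \<open>c l * z + 1 \<noteq> 0\<close> is imposed, as it follows from the ones below: if
  \<open>a l \<noteq> b l * c l\<close>, then a zero of the denominator in the disc would make \<open>\<phi>\<close> unbounded near it,
  whereas if \<open>a l = b l * c l\<close>, it would contradict \<open>cmod (c l) \<le> 1\<close>. Hence the value of a division
  by zero plays no role.\<close>

definition schur2_lf :: "(complex \<times> complex \<Rightarrow> complex) set" where
  "schur2_lf = {\<phi> \<in> schur2. \<exists>a b c :: complex \<Rightarrow> complex.
      c holomorphic_on unit_disc \<and>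
      (\<forall>z\<in>unit_disc. \<forall>l\<in>unit_disc. \<phi> (z, l) = (a l * z + b l) / (c l * z + 1)) \<and>
      (\<forall>l\<in>unit_disc. a l = b l * c l \<longrightarrow> cmod (c l) \<le> 1)}"

end

theory Submission
  imports Defs
begin

no_notation fps_nth (infixl "$" 75)

text \<open>The whole correspondence is the factorisation
  \<open>1 - x\<^sub>1 z - x\<^sub>2 w + x\<^sub>3 z w = (1 - x\<^sub>2 w) (1 - z \<Psi>(w, x))\<close>: its non-vanishing for all \<open>z\<close>, \<open>w\<close> in the
  disc means that the linear fractional map \<open>\<Psi>(\<cdot>, x)\<close> has no pole in the disc and is bounded by \<open>1\<close>
  there. The coefficients correspond via \<open>x = (b, -c, -a)\<close>; when \<open>a \<noteq> b c\<close> the bound on \<open>\<phi>\<close> excludes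
  a pole, and \<open>a\<close>, \<open>b\<close> are analytic because they are recovered from \<open>c\<close> and the slices of \<open>\<phi>\<close> at
  \<open>z = 0\<close> and \<open>z = 1/2\<close>.\<close>

text \<open>The only possible zero in \<open>z\<close> is \<open>inverse u\<close>, and it lies in
  the open disc exactly when \<open>cmod u > 1\<close>.\<close>

lemma cmod_le_1_iff_no_zero:
  fixes u :: complex
  shows "cmod u \<le> 1 \<longleftrightarrow> (\<forall>z\<in>unit_disc. 1 - z * u \<noteq> 0)"
proof
  assume u: "cmod u \<le> 1"
  show "\<forall>z\<in>unit_disc. 1 - z * u \<noteq> 0"
  proof (intro ballI notI)
    fix z assume z: "z \<in> unit_disc" and "1 - z * u = 0"
    then have "cmod z * cmod u = 1"
      by (metis norm_mult norm_one right_minus_eq)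
    moreover have "cmod z * cmod u \<le> cmod z"
      using u by (simp add: mult_left_le)
    ultimately show False
      using z by simp
  qed
next
  assume *: "\<forall>z\<in>unit_disc. 1 - z * u \<noteq> 0"
  show "cmod u \<le> 1"
  proof (rule ccontr)
    assume u: "\<not> cmod u \<le> 1"
    then have "u \<noteq> 0" and "inverse u \<in> unit_disc"
      by (auto simp: norm_inverse inverse_less_1_iff)
    then show False
      using * by force
  qed
qed

lemma closed_tetrablock_denominator:
  fixes x :: "complex ^ 3"
  assumes "x \<in> closed_tetrablock" "w \<in> unit_disc"
  shows "1 - x $ 2 * w \<noteq> 0"
proof -
  have "1 - x $ 1 * 0 - x $ 2 * w + x $ 3 * 0 * w \<noteq> 0"
    using assms unfolding closed_tetrablock_def by (blast intro: centre_in_ball[THEN iffD2, OF zero_less_one])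
  then show ?thesis
    by simp
qed

lemma tetrablock_factorisation:
  fixes x :: "complex ^ 3"
  assumes "1 - x $ 2 * w \<noteq> 0"
  shows "1 - x $ 1 * z - x $ 2 * w + x $ 3 * z * w = (1 - x $ 2 * w) * (1 - z * Psi w x)"
proof -
  have "x $ 2 * w - 1 \<noteq> 0"
    using assms by (metis right_minus_eq)
  then show ?thesis
    by (simp add: Psi_def field_simps)
qed

lemma closed_tetrablock_iff:
  fixes x :: "complex ^ 3"
  shows "x \<in> closed_tetrablock \<longleftrightarrow>
     (\<forall>w\<in>unit_disc. 1 - x $ 2 * w \<noteq> 0 \<and> cmod (Psi w x) \<le> 1)"
proof
  assume x: "x \<in> closed_tetrablock"
  show "\<forall>w\<in>unit_disc. 1 - x $ 2 * w \<noteq> 0 \<and> cmod (Psi w x) \<le> 1"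
  proof
    fix w assume w: "w \<in> unit_disc"
    note nz = closed_tetrablock_denominator[OF x w]
    have "\<forall>z\<in>unit_disc. (1 - x $ 2 * w) * (1 - z * Psi w x) \<noteq> 0"
      using x w unfolding closed_tetrablock_def tetrablock_factorisation[OF nz, symmetric] by blast
    with nz show "1 - x $ 2 * w \<noteq> 0 \<and> cmod (Psi w x) \<le> 1"
      unfolding cmod_le_1_iff_no_zero by simp
  qed
next
  assume *: "\<forall>w\<in>unit_disc. 1 - x $ 2 * w \<noteq> 0 \<and> cmod (Psi w x) \<le> 1"
  then show "x \<in> closed_tetrablock"
    unfolding closed_tetrablock_def cmod_le_1_iff_no_zero
    by (auto simp: tetrablock_factorisation)
qed

text \<open>If \<open>a \<noteq> b * c\<close>, numerator and denominator have no common zero, so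
  the quotient would be unbounded near a pole. If \<open>a = b * c\<close>, the quotient stays
  bounded near the pole, and only \<open>cmod c \<le> 1\<close> keeps the zero
  \<open>- 1 / c\<close> out of the open disc.\<close>

lemma linear_fractional_no_pole:
  fixes a b c z :: complex
  assumes z: "z \<in> unit_disc"
    and bound: "\<And>z. z \<in> unit_disc \<Longrightarrow> cmod ((a * z + b) / (c * z + 1)) \<le> 1"
    and degenerate: "a = b * c \<Longrightarrow> cmod c \<le> 1"
  shows "c * z + 1 \<noteq> 0"
proof
  assume zero: "c * z + 1 = 0"
  show False
  proof (cases "a = b * c")
    case True
    then show False
      using degenerate zero z cmod_le_1_iff_no_zero[of "- c"] by (auto simp: algebra_simps)
  next
    case False
    have c: "c \<noteq> 0"
      using zero by auto
    \<comment> \<open>At \<open>z\<close> itself the bound says nothing, since division by zero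
      yields \<open>0\<close>. At nearby \<open>w \<noteq> z\<close> the denominator is nonzero and
      can be cleared; the limit then carries the inequality to \<open>z\<close>.\<close>
    have "\<forall>\<^sub>F w in at z. cmod (a * w + b) \<le> cmod (c * w + 1)"
      using eventually_at_in_open[OF open_ball z]
    proof eventually_elim
      case (elim w)
      have "c * w \<noteq> c * z"
        using elim c by auto
      then have "c * w + 1 \<noteq> 0"
        using zero by (metis add_right_cancel)
      then show ?case
        using bound[of w] elim by (simp add: norm_divide divide_le_eq)
    qed
    moreover have "((\<lambda>w. cmod (a * w + b)) \<longlongrightarrow> cmod (a * z + b)) (at z)"
      and "((\<lambda>w. cmod (c * w + 1)) \<longlongrightarrow> cmod (c * z + 1)) (at z)"
      by (intro tendsto_intros)+
    ultimately have "cmod (a * z + b) \<le> cmod (c * z + 1)"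
      by (intro tendsto_le[OF at_neq_bot])
    then have "a * z + b = 0"
      using zero by simp
    \<comment> \<open>With \<open>b = - a * z\<close> and \<open>c * z = - 1\<close>, the product
      \<open>b * c\<close> is \<open>- a * (c * z) = a\<close>.\<close>
    then have "a = b * c"
      using zero by algebra
    with False show False ..
  qed
qed

text \<open>Along the direction \<open>(0, k)\<close> the total derivative reduces to
  \<open>B * k\<close>, the second partial derivative. Through such slices the analyticity of
  \<open>\<phi>\<close> passes to the coefficients \<open>a\<close> and \<open>b\<close>.\<close>

lemma holomorphic2_on_slice:
  assumes f: "f holomorphic2_on (S \<times> T)" and z: "z \<in> S"
  shows "(\<lambda>l. f (z, l)) holomorphic_on T"
  unfolding holomorphic_on_def field_differentiable_def
proof
  fix l assume l: "l \<in> T"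
  then obtain A B where D: "(f has_derivative (\<lambda>(h, k). A * h + B * k)) (at (z, l) within S \<times> T)"
    using f z unfolding holomorphic2_on_def by blast
  have "((\<lambda>l. (z, l)) has_derivative (\<lambda>k. (0, k))) (at l within T)"
    by (auto intro!: derivative_eq_intros)
  moreover have "(f has_derivative (\<lambda>(h, k). A * h + B * k)) (at (z, l) within Pair z ` T)"
    using z by (intro has_derivative_subset[OF D]) auto
  ultimately have "((\<lambda>l. f (z, l)) has_derivative (\<lambda>k. case (0, k) of (h, k) \<Rightarrow> A * h + B * k))
      (at l within T)"
    by (rule has_derivative_in_compose)
  then have "((\<lambda>l. f (z, l)) has_derivative (\<lambda>k. B * k)) (at l within T)"
    by simp
  then show "\<exists>f'. ((\<lambda>l. f (z, l)) has_field_derivative f') (at l within T)"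
    unfolding has_field_derivative_def by blast
qed

lemma holomorphic2_on_divide:
  assumes f: "f holomorphic2_on S" and g: "g holomorphic2_on S" and nz: "\<And>p. p \<in> S \<Longrightarrow> g p \<noteq> 0"
  shows "(\<lambda>p. f p / g p) holomorphic2_on S"
  unfolding holomorphic2_on_def
proof
  fix p assume p: "p \<in> S"
  then obtain A B C D where
    "(f has_derivative (\<lambda>(h, k). A * h + B * k)) (at p within S)"
    "(g has_derivative (\<lambda>(h, k). C * h + D * k)) (at p within S)"
    using f g unfolding holomorphic2_on_def by meson
  from has_derivative_divide'[OF this nz[OF p]]
  have "((\<lambda>p. f p / g p) has_derivative
      (\<lambda>(h, k). (A * g p - f p * C) / (g p * g p) * h + (B * g p - f p * D) / (g p * g p) * k))
      (at p within S)"
    by (rule has_derivative_eq_rhs)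
      (auto simp: fun_eq_iff algebra_simps add_divide_distrib diff_divide_distrib)
  then show "\<exists>A B. ((\<lambda>p. f p / g p) has_derivative (\<lambda>(h, k). A * h + B * k)) (at p within S)"
    by blast
qed

text \<open>This shape covers both the numerator of \<open>Psi z (x l)\<close>, with
  \<open>u\<close>, \<open>v\<close> the components 3 and 1 of \<open>x\<close>, and its
  denominator, with component 2 and the constant \<open>1\<close>.\<close>

lemma holomorphic2_on_affine_fst:
  assumes u: "u holomorphic_on T" and v: "v holomorphic_on T" and T: "open T"
  shows "(\<lambda>(z, l). u l * z - v l) holomorphic2_on (S \<times> T)"
  unfolding holomorphic2_on_def
proof
  fix p assume "p \<in> S \<times> T"
  then have "snd p \<in> T"
    by auto
  then obtain du dv where
    "(u has_field_derivative du) (at (snd p))" "(v has_field_derivative dv) (at (snd p))"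
    using u v T unfolding holomorphic_on_open[OF T] by blast
  \<comment> \<open>As \<open>T\<close> is open, \<open>u\<close> and \<open>v\<close> have full
    derivatives at \<open>snd p\<close>, ready for the chain rule with the projection
    \<open>snd\<close>.\<close>
  note D = this[unfolded has_field_derivative_def,
      THEN has_derivative_compose[OF has_derivative_snd[OF has_derivative_ident]]]
  have "((\<lambda>p. u (snd p) * fst p - v (snd p)) has_derivative
      (\<lambda>(h, k). u (snd p) * h + (du * fst p - dv) * k)) (at p within S \<times> T)"
    by (rule has_derivative_eq_rhs, (rule derivative_intros D)+)
      (auto simp: fun_eq_iff algebra_simps)
  then show "\<exists>A B. ((\<lambda>(z, l). u l * z - v l) has_derivative (\<lambda>(h, k). A * h + B * k))
      (at p within S \<times> T)"
    unfolding case_prod_unfold by blast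
qed

text \<open>Needed because \<open>\<phi>\<close> is arbitrary off the bidisc; a derivative within
  \<open>S\<close> at a point of \<open>S\<close> sees only values on \<open>S\<close>.\<close>

lemma holomorphic2_on_cong:
  assumes "\<And>p. p \<in> S \<Longrightarrow> f p = g p" "g holomorphic2_on S"
  shows "f holomorphic2_on S"
  using assms unfolding holomorphic2_on_def by (metis has_derivative_transform)

lemma holomorphic2_on_Psi:
  assumes x: "x \<in> Hol_disc_tetrablock"
  shows "(\<lambda>(z, l). Psi z (x l)) holomorphic2_on (unit_disc \<times> unit_disc)"
proof -
  have hol: "(\<lambda>l. x l $ i) holomorphic_on unit_disc" for i
    using x by (simp add: Hol_disc_tetrablock_def)
  have "(\<lambda>p. (case p of (z, l) \<Rightarrow> x l $ 3 * z - x l $ 1) / (case p of (z, l) \<Rightarrow> x l $ 2 * z - 1))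
      holomorphic2_on (unit_disc \<times> unit_disc)"
  proof (rule holomorphic2_on_divide)
    fix p :: "complex \<times> complex" assume p: "p \<in> unit_disc \<times> unit_disc"
    then have "x (snd p) \<in> closed_tetrablock"
      using x by (auto simp: Hol_disc_tetrablock_def)
    then have "1 - x (snd p) $ 2 * fst p \<noteq> 0"
      using p by (intro closed_tetrablock_denominator) auto
    then show "(case p of (z, l) \<Rightarrow> x l $ 2 * z - 1) \<noteq> 0"
      by (auto simp: case_prod_unfold)
  qed (intro holomorphic2_on_affine_fst hol open_ball holomorphic_on_const)+
  then show ?thesis
    by (simp add: Psi_def case_prod_unfold)
qed

text \<open>Tailored to the \<open>c\<close> that comes from a map into the tetrablock: it is
  bounded by \<open>1\<close> at every \<open>l\<close>, degenerate or not.\<close>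

lemma schur2_lfI:
  assumes "\<phi> \<in> schur2" "c holomorphic_on unit_disc"
    and "\<And>z l. \<lbrakk>z \<in> unit_disc; l \<in> unit_disc\<rbrakk> \<Longrightarrow> \<phi> (z, l) = (a l * z + b l) / (c l * z + 1)"
    and "\<And>l. l \<in> unit_disc \<Longrightarrow> cmod (c l) \<le> 1"
  shows "\<phi> \<in> schur2_lf"
  using assms unfolding schur2_lf_def by blast

theorem proposition7p7:
  fixes \<phi> :: "complex \<times> complex \<Rightarrow> complex"
  shows "\<phi> \<in> schur2_lf \<longleftrightarrow>
    (\<exists>x \<in> Hol_disc_tetrablock. \<forall>z\<in>unit_disc. \<forall>l\<in>unit_disc. \<phi> (z, l) = Psi z (x l))"
proof
  assume "\<phi> \<in> schur2_lf"
  then have "\<phi> \<in> schur2"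
    by (simp add: schur2_lf_def)
  then have hol: "\<phi> holomorphic2_on (unit_disc \<times> unit_disc)"
    and bound: "\<And>z l. \<lbrakk>z \<in> unit_disc; l \<in> unit_disc\<rbrakk> \<Longrightarrow> cmod (\<phi> (z, l)) \<le> 1"
    by (auto simp: schur2_def)
  obtain a b c where c: "c holomorphic_on unit_disc"
    and \<phi>: "\<And>z l. \<lbrakk>z \<in> unit_disc; l \<in> unit_disc\<rbrakk> \<Longrightarrow> \<phi> (z, l) = (a l * z + b l) / (c l * z + 1)"
    and degenerate: "\<And>l. \<lbrakk>l \<in> unit_disc; a l = b l * c l\<rbrakk> \<Longrightarrow> cmod (c l) \<le> 1"
    using \<open>\<phi> \<in> schur2_lf\<close> unfolding schur2_lf_def by blast
  have nz: "c l * z + 1 \<noteq> 0" if "z \<in> unit_disc" "l \<in> unit_disc" for z l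
    using that bound degenerate by (intro linear_fractional_no_pole[of z "a l" "b l"]) (auto simp flip: \<phi>)
  have "(\<lambda>l. \<phi> (0, l)) holomorphic_on unit_disc"
    by (intro holomorphic2_on_slice[OF hol]) simp
  then have b: "b holomorphic_on unit_disc"
    by (rule holomorphic_transform) (simp add: \<phi>)
  have slice: "(\<lambda>l. \<phi> (1/2, l)) holomorphic_on unit_disc"
    by (intro holomorphic2_on_slice[OF hol]) simp
  \<comment> \<open>Clearing the denominator at \<open>z = 1/2\<close> and doubling gives
    \<open>\<phi> (1/2, l) * (c l + 2) = a l + 2 * b l\<close>, which is solved for
    \<open>a l\<close>.\<close>
  have "(\<lambda>l. \<phi> (1/2, l) * (c l + 2) - 2 * b l) holomorphic_on unit_disc"
    by (intro holomorphic_intros b c slice)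
  then have a: "a holomorphic_on unit_disc"
  proof (rule holomorphic_transform)
    fix l :: complex assume l: "l \<in> unit_disc"
    then have "c l * (1/2) + 1 \<noteq> 0" "\<phi> (1/2, l) = (a l * (1/2) + b l) / (c l * (1/2) + 1)"
      by (intro nz \<phi>; simp)+
    then have "\<phi> (1/2, l) * (c l * (1/2) + 1) = a l * (1/2) + b l"
      by simp
    from arg_cong[OF this, of "(*) 2"] show "\<phi> (1/2, l) * (c l + 2) - 2 * b l = a l"
      by (simp add: algebra_simps)
  qed
  define x :: "complex \<Rightarrow> complex ^ 3" where "x l = vector [b l, - c l, - a l]" for l
  have Psi_x: "Psi z (x l) = \<phi> (z, l)" if "z \<in> unit_disc" "l \<in> unit_disc" for z l
  proof -
    \<comment> \<open>The denominator of \<open>Psi\<close> is the negative of the normalised one,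
      so numerator and denominator both change sign.\<close>
    have "Psi z (x l) = - (a l * z + b l) / - (c l * z + 1)"
      by (simp add: Psi_def x_def)
    also have "\<dots> = \<phi> (z, l)"
      unfolding minus_divide_divide \<phi>[OF that] ..
    finally show ?thesis .
  qed
  have "(\<lambda>l. x l $ i) holomorphic_on unit_disc" for i
    using exhaust_3[of i] a b c by (auto simp: x_def intro!: holomorphic_intros)
  moreover have "x l \<in> closed_tetrablock" if l: "l \<in> unit_disc" for l
    unfolding closed_tetrablock_iff
  proof
    fix w assume w: "w \<in> unit_disc"
    have "1 - x l $ 2 * w = c l * w + 1"
      by (simp add: x_def)
    then show "1 - x l $ 2 * w \<noteq> 0 \<and> cmod (Psi w (x l)) \<le> 1"
      using nz[OF w l] bound[OF w l] by (simp only: Psi_x[OF w l]) simp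
  qed
  ultimately have "x \<in> Hol_disc_tetrablock"
    by (simp add: Hol_disc_tetrablock_def)
  with Psi_x show "\<exists>x \<in> Hol_disc_tetrablock. \<forall>z\<in>unit_disc. \<forall>l\<in>unit_disc. \<phi> (z, l) = Psi z (x l)"
    by metis
next
  assume "\<exists>x \<in> Hol_disc_tetrablock. \<forall>z\<in>unit_disc. \<forall>l\<in>unit_disc. \<phi> (z, l) = Psi z (x l)"
  then obtain x where x: "x \<in> Hol_disc_tetrablock"
    and \<phi>: "\<And>z l. \<lbrakk>z \<in> unit_disc; l \<in> unit_disc\<rbrakk> \<Longrightarrow> \<phi> (z, l) = Psi z (x l)"
    by blast
  have "\<phi> holomorphic2_on (unit_disc \<times> unit_disc)"
    by (rule holomorphic2_on_cong[OF _ holomorphic2_on_Psi[OF x]]) (auto simp: \<phi>)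
  moreover have tetra: "x l \<in> closed_tetrablock" if "l \<in> unit_disc" for l
    using x that by (simp add: Hol_disc_tetrablock_def)
  ultimately have "\<phi> \<in> schur2"
    by (auto simp: schur2_def \<phi> closed_tetrablock_iff)
  moreover have "(\<lambda>l. - x l $ 2) holomorphic_on unit_disc"
    using x by (auto simp: Hol_disc_tetrablock_def intro!: holomorphic_intros)
  moreover have "\<phi> (z, l) = (- x l $ 3 * z + x l $ 1) / (- x l $ 2 * z + 1)"
    if "z \<in> unit_disc" "l \<in> unit_disc" for z l
    using minus_divide_divide[of "x l $ 3 * z - x l $ 1" "x l $ 2 * z - 1"]
    by (simp add: \<phi>[OF that] Psi_def)
  \<comment> \<open>The factor \<open>1 - x l $ 2 * w\<close> has no zero \<open>w\<close> in the
    disc, which is the criterion for modulus at most \<open>1\<close>. This settles the degenerate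
    case too, where the bound on \<open>\<phi>\<close> gives no control of \<open>c\<close>.\<close>
  moreover have "cmod (- x l $ 2) \<le> 1" if "l \<in> unit_disc" for l
    using closed_tetrablock_denominator[OF tetra[OF that]] cmod_le_1_iff_no_zero[of "x l $ 2"]
    by (simp add: mult.commute)
  ultimately show "\<phi> \<in> schur2_lf"
    by (rule schur2_lfI)
qed

end
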